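(* Let $(E,\|\cdot\|_E)$ and $(F,\|\cdot\|_F)$ be Banach spaces over $\mathbb{K}$ with Besselian Schauder frames $\mathcal{F}=((a_m,b_m^* ))_{m\in\mathbb{N}^*}\subset E\times E^*$ and $\mathcal{G}=((x_n,y_n^* ))_{n\in\mathbb{N}^*}\subset F\times F^*$, respectively. Let $\mathcal{L}_{\mathcal{F}},\mathcal{L}_{\mathcal{G}}$ be their Besselian constants, and let $\|\cdot\|^{Bess}_{E,\mathcal{F}}$, $\|\cdot\|^{Bess}_{F,\mathcal{G}}$ and $\alpha_{\mathcal{F},\mathcal{G}}^{Bess}$ be the associated Besselian norms and Besselian crossnorm. Let $\varepsilon_{\mathcal{F},\mathcal{G}}$ (resp. $\pi_{\mathcal{F},\mathcal{G}}$) denote the injective (resp. projective) tensor norm on the algebraic tensor product of $(E,\|\cdot\|^{Bess}_{E,\mathcal{F}})$ and $(F,\|\cdot\|^{Bess}_{F,\mathcal{G}})$. Then: 1. For each $u\in E\otimes F$, $$\mathcal{L}_{\mathcal{F}}^{-1}\mathcal{L}_{\mathcal{G}}^{-1}\,\varepsilon_{\mathcal{F},\mathcal{G}}(u)\le \alpha_{\mathcal{F},\mathcal{G}}^{Bess}(u)\le\pi_{\mathcal{F},\mathcal{G}}(u).$$ 2. The mapping $\alpha_{\mathcal{F},\mathcal{G}}^{Bess}$ defines a reasonable crossnorm on the tensor product of $(E,\|\cdot\|^{Bess}_{E,\mathcal{F}})$ and $(F,\|\cdot\|^{Bess}_{F,\mathcal{G}})$. Consequently, for each $u\in E\otimes F$,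 $$\varepsilon_{\mathcal{F},\mathcal{G}}(u)\le \alpha_{\mathcal{F},\mathcal{G}}^{Bess}(u)\le\pi_{\mathcal{F},\mathcal{G}}(u).$$
   Context: $\mathbb{K}=\mathbb{R}$ or $\mathbb{C}$; $\mathbb{N}^*=\{1,2,3,\dots\}$; $E^*$ is the topological dual of $E$; $E\otimes F$ is the algebraic tensor product. A sequence $\mathcal{F}=((a_m,b_m^* ))_{m\in\mathbb{N}^*}\subset E\times E^*$ is a Schauder frame for $E$ if $x=\sum_{m=1}^\infty b_m^*(x)a_m$ (norm convergence) for every $x\in E$. It is a Besselian Schauder frame (BSF) if, in addition, there is $B>0$ with $\sum_{m=1}^\infty|b_m^*(x)||f^*(a_m)|\le B\|x\|_E\|f^*\|_{E^*}$ for all $x\in E$, $f^*\in E^*$. Its Besselian constant is $$\mathcal{L}_{\mathcal{F}}:=\sup_{\|x\|_E\le1,\ \|f^*\|_{E^*}\le1}\sum_{m=1}^\infty|b_m^*(x)||f^*(a_m)|<\infty.$$ The Besselian norm on $E$ is $$\|x\|^{Bess}_{E,\mathcal{F}}:=\sup_{\|f^*\|_{E^*}\le1}\sum_{m=1}^\infty|b_m^*(x)f^*(a_m)|,$$ which is a norm equivalent to $\|\cdot\|_E$; the same definitions apply to $F$ and $\mathcal{G}$. Besselian crossnorm: for a finite sum of elementary tensors put $$Bess\Big(\sum_{r=1}^R x^r\otimes y^r\Big):=\sup_{\|f^*\|_{E^*}\le 1,\ \|g^*\|_{F^*}\le 1}\ \sum_{r=1}^R\sum_{m,n=1}^\infty\left|b_m^*(x^r)\,y_n^*(y^r)\,f^*(a_m)\,g^*(x_n)\right|$$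 (dual norms taken with respect to the original norms $\|\cdot\|_E,\|\cdot\|_F$), and for $u\in E\otimes F$ put $$\alpha_{\mathcal{F},\mathcal{G}}^{Bess}(u):=\inf\Big\{Bess\Big(\sum_{r=1}^R x^r\otimes y^r\Big): u=\sum_{r=1}^R x^r\otimes y^r\Big\},$$ the infimum over all finite representations of $u$. For Banach spaces $X,Y$ and $u=\sum_{r=1}^R x^r\otimes y^r\in X\otimes Y$, the injective norm is $\varepsilon(u)=\sup_{\|f^*\|_{X^*}\le1,\|g^*\|_{Y^*}\le1}|\sum_r f^*(x^r)g^*(y^r)|$ and the projective norm is $\pi(u)=\inf\{\sum_r\|x^r\|_X\|y^r\|_Y:u=\sum_r x^r\otimes y^r\}$. A norm $\alpha$ on $X\otimes Y$ is a reasonable crossnorm if (a) $\alpha(x\otimes y)\le\|x\|_X\|y\|_Y$ for all $x\in X,y\in Y$; and (b) $|(f^*\otimes g^* )(u)|\le\|f^*\|_{X^*}\|g^*\|_{Y^*}\alpha(u)$ for all $f^*\in X^*$, $g^*\in Y^*$, $u\in X\otimes Y$, where $(f^*\otimes g^* )(\sum_r x^r\otimes y^r)=\sum_r f^*(x^r)g^*(y^r)$. In the claim $X=(E,\|\cdot\|^{Bess}_{E,\mathcal{F}})$ and $Y=(F,\|\cdot\|^{Bess}_{F,\mathcal{G}})$, so the dual norms in $\varepsilon_{\mathcal{F},\mathcal{G}}$ and in (b) are the ones dual to the Besselian norms. *)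

theory Defs
  imports "HOL-Analysis.Analysis"
begin

(* The scalar field: up to isometric isomorphism, exactly the reals or the complex numbers. *)
class real_or_complex = real_normed_field +
  assumes real_or_complex:
    "\<exists>\<phi> :: 'a \<Rightarrow> complex.
       (\<forall>x y. \<phi> (x + y) = \<phi> x + \<phi> y) \<and> (\<forall>x y. \<phi> (x * y) = \<phi> x * \<phi> y) \<and>
       (\<forall>x. norm (\<phi> x) = norm x) \<and> (range \<phi> = \<real> \<or> range \<phi> = UNIV)"

instance real :: real_or_complex
proof
  show "\<exists>\<phi> :: real \<Rightarrow> complex.
       (\<forall>x y. \<phi> (x + y) = \<phi> x + \<phi> y) \<and> (\<forall>x y. \<phi> (x * y) = \<phi> x * \<phi> y) \<and>
       (\<forall>x. norm (\<phi> x) = norm x) \<and> (range \<phi> = \<real> \<or> range \<phi> = UNIV)"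
    by (rule exI[of _ complex_of_real]) (auto simp: Reals_def)
qed

instance complex :: real_or_complex
proof
  show "\<exists>\<phi> :: complex \<Rightarrow> complex.
       (\<forall>x y. \<phi> (x + y) = \<phi> x + \<phi> y) \<and> (\<forall>x y. \<phi> (x * y) = \<phi> x * \<phi> y) \<and>
       (\<forall>x. norm (\<phi> x) = norm x) \<and> (range \<phi> = \<real> \<or> range \<phi> = UNIV)"
    by (rule exI[of _ id]) auto
qed

(* Completeness comes from the class banach. The class operation scaleR plays no role of its own:
   the axioms below make it agree with scale on real scalars, see scale_of_real. *)
locale banach_over = vector_space scale
  for scale :: "'k::real_or_complex \<Rightarrow> 'a::banach \<Rightarrow> 'a" +
  assumes norm_scale: "norm (scale c x) = norm c * norm x"
begin

lemma scale_of_real: "scale (of_real r) x = r *\<^sub>R x"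
proof -
  let ?f = "\<lambda>r. scale (of_real r) x"
  have add: "?f (r + s) = ?f r + ?f s" for r s
    by (simp add: scale_left_distrib)
  interpret f: additive ?f
    by standard (rule add)
  have lim: "?f \<midarrow>t\<rightarrow> ?f t" for t
  proof (rule LIM_offset_zero_cancel, rule Lim_null[THEN iffD2])
    have eq: "norm (?f (t + h) - ?f t) = \<bar>h\<bar> * norm x" for h
      by (simp add: scale_left_distrib norm_scale)
    have "((\<lambda>h. norm (?f (t + h) - ?f t)) \<longlongrightarrow> 0) (at 0)"
      unfolding eq by (auto intro!: tendsto_eq_intros)
    then show "((\<lambda>h. ?f (t + h) - ?f t) \<longlongrightarrow> 0) (at 0)"
      by (rule tendsto_norm_zero_cancel)
  qed
  have rat: "?f (of_rat q) = of_rat q *\<^sub>R x" for q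
  proof -
    obtain m n where q: "q = Fract m n" "n > 0" by (cases q) auto
    have nat: "?f (real k * s) = real k *\<^sub>R ?f s" for k s
      by (induction k) (auto simp: ring_distribs scaleR_left_distrib scale_left_distrib)
    have int: "?f (of_int k * s) = of_int k *\<^sub>R ?f s" for k :: int and s
    proof (cases k rule: int_cases2)
      case (nonneg n)
      then show ?thesis using nat[of n s] by simp
    next
      case (nonpos n)
      then show ?thesis using nat[of n s] f.minus[of "real n * s"] by simp
    qed
    have "of_int n *\<^sub>R ?f (of_rat q) = ?f (of_int n * of_rat q)"
      by (rule int[symmetric])
    also have "of_int n * of_rat q = (of_int m * 1 :: real)"
      using q by (simp add: of_rat_rat)
    also have "?f (of_int m * 1) = of_int m *\<^sub>R x"
      unfolding int by simp
    finally have "(1 / of_int n) *\<^sub>R (of_int n *\<^sub>R ?f (of_rat q)) = (1 / of_int n) *\<^sub>R (of_int m *\<^sub>R x)"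
      by simp
    then show ?thesis using q by (simp add: of_rat_rat)
  qed
  have cont: "continuous_on UNIV (\<lambda>r. ?f r - r *\<^sub>R x)"
    by (intro continuous_on_diff continuous_intros)
      (auto simp: continuous_on_def intro: lim)
  have "closed {r. ?f r - r *\<^sub>R x = 0}"
    using continuous_closed_vimage[of "{0}" "\<lambda>r. ?f r - r *\<^sub>R x"] cont
    by (simp add: vimage_def continuous_on_eq_continuous_at)
  moreover have "\<rat> \<subseteq> {r. ?f r - r *\<^sub>R x = 0}"
    using rat by (auto elim!: Rats_cases)
  ultimately have "closure \<rat> \<subseteq> {r. ?f r - r *\<^sub>R x = 0}"
    by (rule closure_minimal[rotated])
  then show ?thesis by (auto simp: Rats_closure_real)
qed

end

(* Norms are passed as functions, since the space E is used both with its own norm and with the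
   Besselian norm. *)
definition dual :: "('k::real_or_complex \<Rightarrow> 'a::ab_group_add \<Rightarrow> 'a) \<Rightarrow> ('a \<Rightarrow> real) \<Rightarrow> ('a \<Rightarrow> 'k) set"
  where "dual s N = {f. Vector_Spaces.linear s (*) f \<and> (\<exists>C. \<forall>x. norm (f x) \<le> C * N x)}"

definition dual_norm :: "('a \<Rightarrow> real) \<Rightarrow> ('a \<Rightarrow> 'k::real_or_complex) \<Rightarrow> real"
  where "dual_norm N f = (SUP x\<in>{x. N x \<le> 1}. norm (f x))"

definition dual_ball :: "('k::real_or_complex \<Rightarrow> 'a::ab_group_add \<Rightarrow> 'a) \<Rightarrow> ('a \<Rightarrow> real) \<Rightarrow> ('a \<Rightarrow> 'k) set"
  where "dual_ball s N = {f \<in> dual s N. dual_norm N f \<le> 1}"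

(* A sequence ((a m, b m)) in E x E* is given by its two components; indices start at 0. *)
definition schauder_frame ::
    "('k::real_or_complex \<Rightarrow> 'a::banach \<Rightarrow> 'a) \<Rightarrow> (nat \<Rightarrow> 'a) \<Rightarrow> (nat \<Rightarrow> 'a \<Rightarrow> 'k) \<Rightarrow> bool"
  where "schauder_frame s a b \<longleftrightarrow>
    (\<forall>m. b m \<in> dual s norm) \<and> (\<forall>x. (\<lambda>m. s (b m x) (a m)) sums x)"

definition besselian_schauder_frame ::
    "('k::real_or_complex \<Rightarrow> 'a::banach \<Rightarrow> 'a) \<Rightarrow> (nat \<Rightarrow> 'a) \<Rightarrow> (nat \<Rightarrow> 'a \<Rightarrow> 'k) \<Rightarrow> bool"
  where "besselian_schauder_frame s a b \<longleftrightarrow> schauder_frame s a b \<and>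
    (\<exists>B>0. \<forall>x. \<forall>f\<in>dual s norm.
       summable (\<lambda>m. norm (b m x) * norm (f (a m))) \<and>
       (\<Sum>m. norm (b m x) * norm (f (a m))) \<le> B * norm x * dual_norm norm f)"

definition bess_const ::
    "('k::real_or_complex \<Rightarrow> 'a::banach \<Rightarrow> 'a) \<Rightarrow> (nat \<Rightarrow> 'a) \<Rightarrow> (nat \<Rightarrow> 'a \<Rightarrow> 'k) \<Rightarrow> real"
  where "bess_const s a b =
    (SUP (x, f)\<in>{x. norm x \<le> 1} \<times> dual_ball s norm. \<Sum>m. norm (b m x) * norm (f (a m)))"

definition bess_norm ::
    "('k::real_or_complex \<Rightarrow> 'a::banach \<Rightarrow> 'a) \<Rightarrow> (nat \<Rightarrow> 'a) \<Rightarrow> (nat \<Rightarrow> 'a \<Rightarrow> 'k) \<Rightarrow> 'a \<Rightarrow> real"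
  where "bess_norm s a b x = (SUP f\<in>dual_ball s norm. \<Sum>m. norm (b m x * f (a m)))"

definition bilinear_map ::
    "('k::real_or_complex \<Rightarrow> 'a::ab_group_add \<Rightarrow> 'a) \<Rightarrow> ('k \<Rightarrow> 'b::ab_group_add \<Rightarrow> 'b) \<Rightarrow>
     ('k \<Rightarrow> 'c::ab_group_add \<Rightarrow> 'c) \<Rightarrow> ('a \<Rightarrow> 'b \<Rightarrow> 'c) \<Rightarrow> bool"
  where "bilinear_map s t r A \<longleftrightarrow>
    (\<forall>y. Vector_Spaces.linear s r (\<lambda>x. A x y)) \<and> (\<forall>x. Vector_Spaces.linear t r (A x))"

(* The algebraic tensor product over the field 'k: the elementary tensor of x and y is evaluation
   of bilinear forms at (x, y), and the tensor product consists of the finite sums of these (the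
   value 0 off the bilinear forms is a dummy). The universal property is tensor_universal below. *)
type_synonym ('k, 'a, 'b) tensor = "('a \<Rightarrow> 'b \<Rightarrow> 'k) \<Rightarrow> 'k"

definition elem_tensor ::
    "('k::real_or_complex \<Rightarrow> 'a::ab_group_add \<Rightarrow> 'a) \<Rightarrow> ('k \<Rightarrow> 'b::ab_group_add \<Rightarrow> 'b) \<Rightarrow>
     'a \<Rightarrow> 'b \<Rightarrow> ('k, 'a, 'b) tensor"
  where "elem_tensor s t x y = (\<lambda>A. if bilinear_map s t (*) A then A x y else 0)"

definition tensor_sum ::
    "('k::real_or_complex \<Rightarrow> 'a::ab_group_add \<Rightarrow> 'a) \<Rightarrow> ('k \<Rightarrow> 'b::ab_group_add \<Rightarrow> 'b) \<Rightarrow>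
     ('a \<times> 'b) list \<Rightarrow> ('k, 'a, 'b) tensor"
  where "tensor_sum s t rep = (\<lambda>A. \<Sum>(x, y)\<leftarrow>rep. elem_tensor s t x y A)"

definition tensor_space ::
    "('k::real_or_complex \<Rightarrow> 'a::ab_group_add \<Rightarrow> 'a) \<Rightarrow> ('k \<Rightarrow> 'b::ab_group_add \<Rightarrow> 'b) \<Rightarrow>
     ('k, 'a, 'b) tensor set"
  where "tensor_space s t = range (tensor_sum s t)"

definition tensor_add ::
    "('k::real_or_complex, 'a, 'b) tensor \<Rightarrow> ('k, 'a, 'b) tensor \<Rightarrow> ('k, 'a, 'b) tensor"
  where "tensor_add u v = (\<lambda>A. u A + v A)"

definition tensor_scale :: "'k::real_or_complex \<Rightarrow> ('k, 'a, 'b) tensor \<Rightarrow> ('k, 'a, 'b) tensor"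
  where "tensor_scale c u = (\<lambda>A. c * u A)"

definition tensor_zero :: "('k::real_or_complex, 'a, 'b) tensor"
  where "tensor_zero = (\<lambda>A. 0)"

(* The functional f (x) g on the tensor product, see tensor_functional_sum. *)
definition tensor_functional ::
    "('a \<Rightarrow> 'k::real_or_complex) \<Rightarrow> ('b \<Rightarrow> 'k) \<Rightarrow> ('k, 'a, 'b) tensor \<Rightarrow> 'k"
  where "tensor_functional f g u = u (\<lambda>x y. f x * g y)"

definition injective_norm ::
    "('k::real_or_complex \<Rightarrow> 'a::ab_group_add \<Rightarrow> 'a) \<Rightarrow> ('a \<Rightarrow> real) \<Rightarrow>
     ('k \<Rightarrow> 'b::ab_group_add \<Rightarrow> 'b) \<Rightarrow> ('b \<Rightarrow> real) \<Rightarrow> ('k, 'a, 'b) tensor \<Rightarrow> real"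
  where "injective_norm s N t M u =
    (SUP (f, g)\<in>dual_ball s N \<times> dual_ball t M. norm (tensor_functional f g u))"

definition projective_norm ::
    "('k::real_or_complex \<Rightarrow> 'a::ab_group_add \<Rightarrow> 'a) \<Rightarrow> ('a \<Rightarrow> real) \<Rightarrow>
     ('k \<Rightarrow> 'b::ab_group_add \<Rightarrow> 'b) \<Rightarrow> ('b \<Rightarrow> real) \<Rightarrow> ('k, 'a, 'b) tensor \<Rightarrow> real"
  where "projective_norm s N t M u =
    (INF rep\<in>{rep. tensor_sum s t rep = u}. \<Sum>(x, y)\<leftarrow>rep. N x * M y)"

definition norm_on_tensor ::
    "('k::real_or_complex \<Rightarrow> 'a::ab_group_add \<Rightarrow> 'a) \<Rightarrow> ('k \<Rightarrow> 'b::ab_group_add \<Rightarrow> 'b) \<Rightarrow>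
     (('k, 'a, 'b) tensor \<Rightarrow> real) \<Rightarrow> bool"
  where "norm_on_tensor s t \<alpha> \<longleftrightarrow>
    (\<forall>u\<in>tensor_space s t. 0 \<le> \<alpha> u \<and> (\<alpha> u = 0 \<longleftrightarrow> u = tensor_zero)) \<and>
    (\<forall>u\<in>tensor_space s t. \<forall>c. \<alpha> (tensor_scale c u) = norm c * \<alpha> u) \<and>
    (\<forall>u\<in>tensor_space s t. \<forall>v\<in>tensor_space s t. \<alpha> (tensor_add u v) \<le> \<alpha> u + \<alpha> v)"

definition reasonable_crossnorm ::
    "('k::real_or_complex \<Rightarrow> 'a::ab_group_add \<Rightarrow> 'a) \<Rightarrow> ('a \<Rightarrow> real) \<Rightarrow>
     ('k \<Rightarrow> 'b::ab_group_add \<Rightarrow> 'b) \<Rightarrow> ('b \<Rightarrow> real) \<Rightarrow> (('k, 'a, 'b) tensor \<Rightarrow> real) \<Rightarrow> bool"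
  where "reasonable_crossnorm s N t M \<alpha> \<longleftrightarrow>
    norm_on_tensor s t \<alpha> \<and>
    (\<forall>x y. \<alpha> (elem_tensor s t x y) \<le> N x * M y) \<and>
    (\<forall>f\<in>dual s N. \<forall>g\<in>dual t M. \<forall>u\<in>tensor_space s t.
       norm (tensor_functional f g u) \<le> dual_norm N f * dual_norm M g * \<alpha> u)"

(* The functional Bess, which depends on the chosen representation of a tensor. *)
definition bess_rep ::
    "('k::real_or_complex \<Rightarrow> 'a::banach \<Rightarrow> 'a) \<Rightarrow> (nat \<Rightarrow> 'a) \<Rightarrow> (nat \<Rightarrow> 'a \<Rightarrow> 'k) \<Rightarrow>
     ('k \<Rightarrow> 'b::banach \<Rightarrow> 'b) \<Rightarrow> (nat \<Rightarrow> 'b) \<Rightarrow> (nat \<Rightarrow> 'b \<Rightarrow> 'k) \<Rightarrow> ('a \<times> 'b) list \<Rightarrow> real"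
  where "bess_rep s a b t x y rep =
    (SUP (f, g)\<in>dual_ball s norm \<times> dual_ball t norm.
       \<Sum>(v, w)\<leftarrow>rep. \<Sum>\<^sub>\<infinity>(m, n)\<in>UNIV. norm (b m v * y n w * f (a m) * g (x n)))"

definition bess_crossnorm ::
    "('k::real_or_complex \<Rightarrow> 'a::banach \<Rightarrow> 'a) \<Rightarrow> (nat \<Rightarrow> 'a) \<Rightarrow> (nat \<Rightarrow> 'a \<Rightarrow> 'k) \<Rightarrow>
     ('k \<Rightarrow> 'b::banach \<Rightarrow> 'b) \<Rightarrow> (nat \<Rightarrow> 'b) \<Rightarrow> (nat \<Rightarrow> 'b \<Rightarrow> 'k) \<Rightarrow> ('k, 'a, 'b) tensor \<Rightarrow> real"
  where "bess_crossnorm s a b t x y u =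
    (INF rep\<in>{rep. tensor_sum s t rep = u}. bess_rep s a b t x y rep)"

lemma vector_space_mult: "vector_space ((*) :: 'k::real_or_complex \<Rightarrow> 'k \<Rightarrow> 'k)"
  by standard (auto simp: algebra_simps)

lemma bilinear_elem_tensor:
  assumes "vector_space s" "vector_space t"
  shows "elem_tensor s t (x + x') y = tensor_add (elem_tensor s t x y) (elem_tensor s t x' y)"
    and "elem_tensor s t x (y + y') = tensor_add (elem_tensor s t x y) (elem_tensor s t x y')"
    and "elem_tensor s t (s c x) y = tensor_scale c (elem_tensor s t x y)"
    and "elem_tensor s t x (t c y) = tensor_scale c (elem_tensor s t x y)"
  unfolding elem_tensor_def tensor_add_def tensor_scale_def bilinear_map_def
  by (auto simp: fun_eq_iff Vector_Spaces.linear_iff)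

lemma tensor_functional_sum:
  assumes "f \<in> dual s N" "g \<in> dual t M"
  shows "tensor_functional f g (tensor_sum s t rep) = (\<Sum>(x, y)\<leftarrow>rep. f x * g y)"
proof -
  have "bilinear_map s t (*) (\<lambda>x y. f x * g y)"
    using assms unfolding dual_def bilinear_map_def Vector_Spaces.linear_iff
    by (auto simp: algebra_simps)
  then show ?thesis
    by (simp add: tensor_functional_def tensor_sum_def elem_tensor_def)
qed

lemma tensor_sum_eq_imp:
  fixes s :: "'k::real_or_complex \<Rightarrow> 'a::ab_group_add \<Rightarrow> 'a"
    and t :: "'k \<Rightarrow> 'b::ab_group_add \<Rightarrow> 'b" and r :: "'k \<Rightarrow> 'c::ab_group_add \<Rightarrow> 'c"
  assumes r: "vector_space r" and T: "bilinear_map s t r T"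
    and eq: "tensor_sum s t rep = tensor_sum s t rep'"
  shows "(\<Sum>(x, y)\<leftarrow>rep. T x y) = (\<Sum>(x, y)\<leftarrow>rep'. T x y)"
proof (rule ccontr)
  assume ne: "\<not> ?thesis"
  define z where "z = (\<Sum>(x, y)\<leftarrow>rep. T x y) - (\<Sum>(x, y)\<leftarrow>rep'. T x y)"
  interpret r: vector_space r by (rule r)
  interpret k: vector_space "(*) :: 'k \<Rightarrow> 'k \<Rightarrow> 'k" by (rule vector_space_mult)
  interpret rk: vector_space_pair r "(*) :: 'k \<Rightarrow> 'k \<Rightarrow> 'k" ..
  have "r.independent {z}" using ne by (simp add: z_def)
  then obtain h where h: "Vector_Spaces.linear r (*) h" "h z = 1"
    using rk.linear_independent_extend[of "{z}" "\<lambda>_. 1"] by auto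
  have hT: "bilinear_map s t (*) (\<lambda>x y. h (T x y))"
    using T h(1) unfolding bilinear_map_def Vector_Spaces.linear_iff by auto
  have h_add: "h (p + q) = h p + h q" for p q using h(1) by (simp add: Vector_Spaces.linear_iff)
  have h_0: "h 0 = 0" using h_add[of 0 0] by simp
  have hsum: "h (\<Sum>(x, y)\<leftarrow>l. T x y) = (\<Sum>(x, y)\<leftarrow>l. h (T x y))" for l
    by (induction l) (auto simp: h_add h_0)
  have "(\<Sum>(x, y)\<leftarrow>rep. h (T x y)) = (\<Sum>(x, y)\<leftarrow>rep'. h (T x y))"
    using fun_cong[OF eq, of "\<lambda>x y. h (T x y)"] hT by (simp add: tensor_sum_def elem_tensor_def)
  then have "h z = 0"
    using h_add[of z "\<Sum>(x, y)\<leftarrow>rep'. T x y"] by (simp add: z_def hsum)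
  then show False using h(2) by simp
qed

lemma tensor_universal:
  fixes s :: "'k::real_or_complex \<Rightarrow> 'a::ab_group_add \<Rightarrow> 'a"
    and t :: "'k \<Rightarrow> 'b::ab_group_add \<Rightarrow> 'b" and r :: "'k \<Rightarrow> 'c::ab_group_add \<Rightarrow> 'c"
  assumes "vector_space s" "vector_space t" "vector_space r" "bilinear_map s t r T"
  shows "\<exists>L. (\<forall>x y. L (elem_tensor s t x y) = T x y) \<and>
    (\<forall>u\<in>tensor_space s t. \<forall>v\<in>tensor_space s t. L (tensor_add u v) = L u + L v) \<and>
    (\<forall>u\<in>tensor_space s t. \<forall>c. L (tensor_scale c u) = r c (L u))"
proof -
  interpret r: vector_space r by fact
  define S where "S rep = (\<Sum>(x, y)\<leftarrow>rep. T x y)" for rep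
  define L where "L u = S (SOME rep. tensor_sum s t rep = u)" for u
  have L: "L (tensor_sum s t rep) = S rep" for rep
    unfolding L_def S_def
    by (rule tensor_sum_eq_imp[OF assms(3,4)]) (rule someI[where x = rep], rule refl)
  have 1: "elem_tensor s t x y = tensor_sum s t [(x, y)]" for x y
    by (simp add: tensor_sum_def)
  have 2: "tensor_add (tensor_sum s t p) (tensor_sum s t q) = tensor_sum s t (p @ q)" for p q
    by (simp add: tensor_sum_def tensor_add_def)
  have 3: "tensor_scale c (tensor_sum s t p) = tensor_sum s t (map (\<lambda>(x, y). (s c x, y)) p)" for c p
  proof (induction p)
    case Nil
    then show ?case by (simp add: tensor_sum_def tensor_scale_def)
  next
    case (Cons p ps)
    then show ?case
      using bilinear_elem_tensor(3)[OF assms(1,2), of c "fst p" "snd p"]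
      by (auto simp: tensor_sum_def tensor_scale_def fun_eq_iff ring_distribs split: prod.splits)
  qed
  have T3: "T (s c x) y = r c (T x y)" for c x y
    using assms(4) by (simp add: bilinear_map_def Vector_Spaces.linear_iff)
  have S3: "S (map (\<lambda>(x, y). (s c x, y)) p) = r c (S p)" for c p
    by (induction p) (auto simp: S_def T3 r.scale_right_distrib)
  show ?thesis
    by (rule exI[of _ L]) (auto simp: tensor_space_def 1 2 3 L S3, auto simp: S_def)
qed

end

theory Submission
  imports Defs
begin

text \<open>
  Write \<open>S v f\<close> for the series \<open>\<Sum>m. norm (b m v) * norm (f (a m))\<close> of a frame, so that the Besselian
  norm \<open>N v\<close> is the supremum of \<open>S v f\<close> over the dual unit ball of the original norm. The double
  series in the definition of \<open>Bess\<close> factors into a product of two such series, which gives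
  \<open>Bess rep \<le> (\<Sum>(v, w)\<leftarrow>rep. N v * N w)\<close> and hence the bound by the projective norm
  (\<open>bess_rep_le_projective\<close>). Homogeneity and the triangle inequality of the crossnorm come from
  rescaling and concatenating representations.

  The main point is the lower estimate
  \<open>norm (\<Sum>(v, w)\<leftarrow>rep. f v * g w) \<le> dual_norm N f * dual_norm N g * Bess rep\<close> for functionals that are
  bounded in the Besselian norms (\<open>functional_le_bess_rep\<close>). The dual unit ball of \<open>N\<close> is in general larger than
  that of the original norm, over which \<open>Bess\<close> takes its supremum, so expanding \<open>f\<close> and \<open>g\<close> along the
  frames would lose the factor of the Besselian constants. Instead the functionals are removed one at a time.
  The left-hand side is \<open>norm (f z)\<close> with \<open>z = (\<Sum>(v, w)\<leftarrow>rep. g w v)\<close>, and is at most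
  \<open>dual_norm N f * N z\<close>. For \<open>h\<close> in the original dual ball, a partial sum of \<open>S z h\<close> has the form
  \<open>\<Sum>m<K. norm (g (w\<^sub>m)) * norm (h (a m))\<close> with \<open>w\<^sub>m = (\<Sum>(v, w)\<leftarrow>rep. b m v w)\<close>; inserting phases
  makes it the value of the single functional \<open>g\<close> at a combination of the \<open>w\<^sub>m\<close>, whose
  Besselian norm is at most \<open>Bess rep\<close> because \<open>S\<close> is a seminorm in its first argument.

  This estimate yields the bound by the injective norm. It also yields definiteness: the coefficient
  functionals \<open>b m\<close> with \<open>a m \<noteq> 0\<close> are bounded in the Besselian norm and separate points, and a tensor
  annihilated by all products of functionals from two separating families is zero. The version weighted by the
  inverse Besselian constants is weaker, since a Besselian constant is at least 1 unless it is 0, as on the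
  zero space (\<open>bess_const_cases\<close>).\<close>

section \<open>Sums over lists and double series\<close>

lemma additive_sum_list:
  fixes f :: "'a::ab_group_add \<Rightarrow> 'b::ab_group_add"
  assumes "\<And>u v. f (u + v) = f u + f v"
  shows "f (\<Sum>p\<leftarrow>l. h p) = (\<Sum>p\<leftarrow>l. f (h p))"
proof -
  have "f 0 = 0" using assms[of 0 0] by simp
  then show ?thesis by (induction l) (simp_all add: assms)
qed

lemma sum_sum_list_swap:
  "(\<Sum>m\<in>A. \<Sum>p\<leftarrow>l. h m p) = (\<Sum>p\<leftarrow>l. \<Sum>m\<in>A. h m p)"
  for h :: "'a \<Rightarrow> 'b \<Rightarrow> 'c::comm_monoid_add"
  by (induction l) (simp_all add: sum.distrib)

lemma infsum_prod_eq_suminf_mult: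
  fixes p q :: "nat \<Rightarrow> real"
  assumes p: "summable p" "\<And>m. 0 \<le> p m" and q: "summable q" "\<And>n. 0 \<le> q n"
  shows "(\<Sum>\<^sub>\<infinity>(m, n)\<in>UNIV. p m * q n) = suminf p * suminf q"
proof -
  have P: "(p has_sum suminf p) UNIV" and Q: "(q has_sum suminf q) UNIV"
    using p q by (auto intro: sums_nonneg_imp_has_sum summable_sums)
  have row: "((\<lambda>n. (\<lambda>(m, n). p m * q n) (m, n)) has_sum p m * suminf q) UNIV" for m
    using has_sum_cmult_right[OF Q, of "p m"] by simp
  have col: "((\<lambda>m. p m * suminf q) has_sum suminf p * suminf q) UNIV"
    by (rule has_sum_cmult_left[OF P])
  have "(\<lambda>(m, n). p m * q n) summable_on Sigma UNIV (\<lambda>_. UNIV)"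
    by (rule summable_on_SigmaI[OF row]) (use p q col in \<open>auto simp: summable_on_def\<close>)
  from has_sum_SigmaI[OF row col this] show ?thesis
    by (simp add: infsumI)
qed

section \<open>Functionals and dual norms\<close>

lemma dual_add: "f \<in> dual s N \<Longrightarrow> f (u + v) = f u + f v"
  and dual_scale: "f \<in> dual s N \<Longrightarrow> f (s c u) = c * f u"
  by (auto simp: dual_def Vector_Spaces.linear_iff)

lemma dual_zero: "f \<in> dual s N \<Longrightarrow> f 0 = 0"
  using dual_add[of f s N 0 0] by simp

lemma dual_diff: "f \<in> dual s N \<Longrightarrow> f (u - v) = f u - f v"
  using dual_add[of f s N "u - v" v] by simp

lemma dual_sum: "f \<in> dual s N \<Longrightarrow> f (\<Sum>m\<in>A. h m) = (\<Sum>m\<in>A. f (h m))"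
  by (induction A rule: infinite_finite_induct) (simp_all add: dual_add dual_zero)

lemma dual_sum_list: "f \<in> dual s N \<Longrightarrow> f (\<Sum>p\<leftarrow>l. h p) = (\<Sum>p\<leftarrow>l. f (h p))"
  by (rule additive_sum_list) (rule dual_add)

lemma dual_bounded:
  assumes "f \<in> dual s N" "\<And>u. 0 \<le> N u"
  obtains C where "0 \<le> C" "\<And>u. norm (f u) \<le> C * N u"
proof -
  from assms(1) obtain C where C: "\<And>u. norm (f u) \<le> C * N u" by (auto simp: dual_def)
  have "norm (f u) \<le> \<bar>C\<bar> * N u" for u
    using C[of u] assms(2)[of u] by (meson abs_ge_self mult_right_mono order_trans)
  then show ?thesis using that[of "\<bar>C\<bar>"] by simp
qed

lemma dual_norm_bdd:
  assumes "f \<in> dual s N" "\<And>u. 0 \<le> N u"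
  shows "bdd_above ((\<lambda>u. norm (f u)) ` {u. N u \<le> 1})"
proof -
  obtain C where C: "0 \<le> C" "\<And>u. norm (f u) \<le> C * N u"
    using dual_bounded[OF assms] by blast
  have "norm (f u) \<le> C" if "N u \<le> 1" for u
    using C(2)[of u] mult_left_mono[OF that C(1)] by simp
  then show ?thesis by (intro bdd_aboveI2[where M = C]) auto
qed

lemma norm_le_dual_norm:
  assumes "f \<in> dual s N" "\<And>u. 0 \<le> N u" "N u \<le> 1"
  shows "norm (f u) \<le> dual_norm N f"
  unfolding dual_norm_def using assms by (intro cSUP_upper dual_norm_bdd) auto

lemma dual_norm_le:
  assumes "N 0 = 0" "\<And>u. N u \<le> 1 \<Longrightarrow> norm (f u) \<le> c"
  shows "dual_norm N f \<le> c"
proof -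
  have "{u. N u \<le> 1} \<noteq> {}" using assms(1) by (auto intro!: exI[of _ 0])
  then show ?thesis unfolding dual_norm_def by (rule cSUP_least) (use assms(2) in auto)
qed

lemma dual_norm_nonneg:
  assumes "f \<in> dual s N" "\<And>u. 0 \<le> N u" "N 0 = 0"
  shows "0 \<le> dual_norm N f"
proof -
  have "norm (f 0) \<le> dual_norm N f"
    by (rule norm_le_dual_norm[OF assms(1,2)]) (simp add: assms(3))
  then show ?thesis using norm_ge_zero[of "f 0"] by linarith
qed

text \<open>\<open>N\<close> need not be definite: where it vanishes, so does every functional in its dual.\<close>
lemma norm_dual_le:
  fixes N :: "'a::ab_group_add \<Rightarrow> real"
  assumes f: "f \<in> dual s N" and N: "\<And>u. 0 \<le> N u" "\<And>c u. N (s c u) = norm c * N u"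
  shows "norm (f u) \<le> dual_norm N f * N u"
proof (cases "N u = 0")
  case True
  then show ?thesis using dual_bounded[OF f N(1)] by (metis mult_zero_right)
next
  case False
  then have pos: "0 < N u" using N(1)[of u] by linarith
  have "norm (f (s (of_real (inverse (N u))) u)) \<le> dual_norm N f"
    using pos by (intro norm_le_dual_norm[OF f N(1)]) (simp add: N(2) norm_inverse)
  then show ?thesis
    using pos by (simp add: dual_scale[OF f] norm_mult norm_divide norm_inverse field_simps)
qed

lemma zero_in_dual_ball:
  fixes s :: "'k::real_or_complex \<Rightarrow> 'a::ab_group_add \<Rightarrow> 'a"
  assumes "vector_space s" "N 0 = 0"
  shows "(\<lambda>_. 0) \<in> dual_ball s N"
proof -
  have "(\<lambda>_. 0) \<in> dual s N"
    using assms(1) by (auto simp: dual_def Vector_Spaces.linear_iff vector_space_mult intro: exI[of _ 0])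
  moreover have "dual_norm N (\<lambda>_. 0 :: 'k) \<le> 1" by (rule dual_norm_le[of N, OF assms(2)]) simp
  ultimately show ?thesis by (simp add: dual_ball_def)
qed

lemma dual_mult:
  assumes f: "f \<in> dual s N" "\<And>u. 0 \<le> N u"
  shows "(\<lambda>u. c * f u) \<in> dual s N"
proof -
  obtain C where "\<And>u. norm (f u) \<le> C * N u"
    using dual_bounded[OF f] by blast
  then have "\<forall>u. norm (c * f u) \<le> (norm c * C) * N u"
    by (simp add: norm_mult mult.assoc mult_left_mono)
  moreover have "Vector_Spaces.linear s (*) (\<lambda>u. c * f u)"
    using f(1) by (simp add: dual_def Vector_Spaces.linear_iff algebra_simps)
  ultimately show ?thesis by (auto simp: dual_def)
qed

lemma dual_norm_mult_le:
  assumes f: "f \<in> dual s N" "\<And>u. 0 \<le> N u" "N 0 = 0"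
  shows "dual_norm N (\<lambda>u. c * f u) \<le> norm c * dual_norm N f"
  by (rule dual_norm_le[of N, OF f(3)])
    (simp add: norm_mult mult_left_mono norm_le_dual_norm[OF f(1,2)])

lemma rescale_in_dual_ball:
  fixes s :: "'k::real_or_complex \<Rightarrow> 'a::ab_group_add \<Rightarrow> 'a"
  assumes f: "f \<in> dual s N" "\<And>u. 0 \<le> N u" "N 0 = 0" and d: "0 < d" "dual_norm N f \<le> d"
  shows "(\<lambda>u. of_real (inverse d) * f u) \<in> dual_ball s N"
proof -
  have "norm (of_real (inverse d) :: 'k) = inverse d"
    unfolding norm_of_real using d by simp
  then have "dual_norm N (\<lambda>u. of_real (inverse d) * f u) \<le> inverse d * dual_norm N f"
    using dual_norm_mult_le[OF f, of "of_real (inverse d)"] by simp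
  also have "\<dots> \<le> 1" using d by (simp add: field_simps)
  finally show ?thesis
    using dual_mult[OF f(1,2), of "of_real (inverse d)"] by (simp add: dual_ball_def)
qed

section \<open>Tensors annihilated by separating families of functionals\<close>

text \<open>
  Expanding the second factors in a Hamel basis with coordinate functionals \<open>c e\<close> turns
  \<open>\<Sum>(v, w)\<leftarrow>rep. A v w\<close> into \<open>\<Sum>e. A (\<Sum>(v, w)\<leftarrow>rep. c e w v) e\<close>. Every inner sum is zero because \<open>\<Phi>\<close>
  separates points: its value under \<open>\<phi> \<in> \<Phi>\<close> is the \<open>e\<close>-coordinate of \<open>\<Sum>(v, w)\<leftarrow>rep. \<phi> v w\<close>, and this vector
  is zero because \<open>\<Psi>\<close> separates points.\<close>
lemma tensor_sum_eq_zeroI: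
  fixes s :: "'k::real_or_complex \<Rightarrow> 'a::ab_group_add \<Rightarrow> 'a"
    and t :: "'k \<Rightarrow> 'b::ab_group_add \<Rightarrow> 'b"
  assumes "vector_space t"
    and Phi: "\<And>\<phi>. \<phi> \<in> \<Phi> \<Longrightarrow> Vector_Spaces.linear s (*) \<phi>" "\<And>v. (\<And>\<phi>. \<phi> \<in> \<Phi> \<Longrightarrow> \<phi> v = 0) \<Longrightarrow> v = 0"
    and Psi: "\<And>\<psi>. \<psi> \<in> \<Psi> \<Longrightarrow> Vector_Spaces.linear t (*) \<psi>" "\<And>w. (\<And>\<psi>. \<psi> \<in> \<Psi> \<Longrightarrow> \<psi> w = 0) \<Longrightarrow> w = 0"
    and zero: "\<And>\<phi> \<psi>. \<phi> \<in> \<Phi> \<Longrightarrow> \<psi> \<in> \<Psi> \<Longrightarrow> (\<Sum>(v, w)\<leftarrow>rep. \<phi> v * \<psi> w) = 0"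
  shows "tensor_sum s t rep = tensor_zero"
proof -
  interpret t: vector_space t by fact
  have slice: "(\<Sum>p\<leftarrow>rep. t (\<phi> (fst p)) (snd p)) = 0" if "\<phi> \<in> \<Phi>" for \<phi>
  proof (rule Psi(2))
    fix \<psi> assume psi: "\<psi> \<in> \<Psi>"
    have "\<psi> (\<Sum>p\<leftarrow>rep. t (\<phi> (fst p)) (snd p)) = (\<Sum>p\<leftarrow>rep. \<psi> (t (\<phi> (fst p)) (snd p)))"
      using Psi(1)[OF psi] by (intro additive_sum_list) (simp add: Vector_Spaces.linear_iff)
    also have "\<dots> = (\<Sum>p\<leftarrow>rep. \<phi> (fst p) * \<psi> (snd p))"
      using Psi(1)[OF psi] by (simp add: Vector_Spaces.linear_iff)
    finally show "\<psi> (\<Sum>p\<leftarrow>rep. t (\<phi> (fst p)) (snd p)) = 0"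
      using zero[OF that psi] by (simp add: case_prod_beta')
  qed
  define H where "H = t.extend_basis {}"
  have H: "t.independent H" "t.span H = UNIV"
    using t.independent_extend_basis[of "{}"] t.span_extend_basis[of "{}"]
    by (auto simp: H_def t.independent_empty)
  define c where "c e w = t.representation H w e" for e w
  have c_add: "c e (w + w') = c e w + c e w'" and c_scale: "c e (t k w) = k * c e w" for e w w' k
    using H by (simp_all add: c_def t.representation_add t.representation_scale)
  have coord: "(\<Sum>p\<leftarrow>rep. s (c e (snd p)) (fst p)) = 0" for e
  proof (rule Phi(2))
    fix \<phi> assume phi: "\<phi> \<in> \<Phi>"
    have "\<phi> (\<Sum>p\<leftarrow>rep. s (c e (snd p)) (fst p)) = (\<Sum>p\<leftarrow>rep. \<phi> (s (c e (snd p)) (fst p)))"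
      using Phi(1)[OF phi] by (intro additive_sum_list) (simp add: Vector_Spaces.linear_iff)
    also have "\<dots> = (\<Sum>p\<leftarrow>rep. c e (t (\<phi> (fst p)) (snd p)))"
      using Phi(1)[OF phi] by (simp add: Vector_Spaces.linear_iff c_scale mult.commute)
    also have "\<dots> = c e (\<Sum>p\<leftarrow>rep. t (\<phi> (fst p)) (snd p))"
      by (rule additive_sum_list[symmetric]) (rule c_add)
    also have "\<dots> = 0" using c_add[of e 0 0] by (simp add: slice[OF phi])
    finally show "\<phi> (\<Sum>p\<leftarrow>rep. s (c e (snd p)) (fst p)) = 0" .
  qed
  \<comment> \<open>a finite set of basis vectors that supports all second factors\<close>
  define S where "S = (\<Union>p\<in>set rep. {e. c e (snd p) \<noteq> 0})"
  have finS: "finite S" by (auto simp: S_def c_def t.finite_representation)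
  have expand: "w = (\<Sum>e\<in>S. t (c e w) e)" if "(v, w) \<in> set rep" for v w
  proof -
    have "(\<Sum>e\<in>S. t (c e w) e) = (\<Sum>e | c e w \<noteq> 0. t (c e w) e)"
      using that by (intro sum.mono_neutral_right finS) (force simp: S_def)+
    also have "\<dots> = w" using H by (simp add: c_def t.sum_nonzero_representation_eq)
    finally show ?thesis by simp
  qed
  have "(\<Sum>(v, w)\<leftarrow>rep. A v w) = 0" if A: "bilinear_map s t (*) A" for A
  proof -
    have A1: "A (v + v') w = A v w + A v' w" "A (s k v) w = k * A v w"
      and A2: "A v (w + w') = A v w + A v w'" "A v (t k w) = k * A v w" for v v' w w' k
      using A by (auto simp: bilinear_map_def Vector_Spaces.linear_iff)
    have A0: "A 0 w = 0" "A v 0 = 0" for v w using A1(1)[of 0 0 w] A2(1)[of v 0 0] by auto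
    have A2_sum: "A v (\<Sum>e\<in>S. h e) = (\<Sum>e\<in>S. A v (h e))" for v h
      using finS by (induction S) (simp_all add: A0 A2)
    have "(\<Sum>(v, w)\<leftarrow>rep. A v w) = (\<Sum>p\<leftarrow>rep. \<Sum>e\<in>S. A (s (c e (snd p)) (fst p)) e)"
    proof (rule arg_cong[of _ _ sum_list], rule map_cong[OF refl])
      fix p assume p: "p \<in> set rep"
      have "A (fst p) (snd p) = A (fst p) (\<Sum>e\<in>S. t (c e (snd p)) e)"
        using expand[of "fst p" "snd p"] p by simp
      then show "(case p of (v, w) \<Rightarrow> A v w) = (\<Sum>e\<in>S. A (s (c e (snd p)) (fst p)) e)"
        by (simp add: case_prod_beta A2_sum A1 A2)
    qed
    also have "\<dots> = (\<Sum>e\<in>S. A (\<Sum>p\<leftarrow>rep. s (c e (snd p)) (fst p)) e)"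
      unfolding sum_sum_list_swap[symmetric]
      by (rule sum.cong[OF refl], rule additive_sum_list[symmetric]) (rule A1)
    also have "\<dots> = 0" by (simp add: coord A0)
    finally show ?thesis .
  qed
  then have "tensor_sum s t rep A = 0" for A
    by (cases "bilinear_map s t (*) A") (simp_all add: tensor_sum_def elem_tensor_def case_prod_beta')
  then show ?thesis by (simp add: tensor_zero_def fun_eq_iff)
qed

section \<open>The Besselian norm of a frame\<close>

text \<open>
  The series of the absolute values \<open>\<bar>b m u * f (a m)\<bar>\<close>, for a vector \<open>u\<close> and a functional \<open>f\<close>. It is a
  seminorm in \<open>u\<close> when the frame is Besselian and \<open>f\<close> is bounded.\<close>
definition frame_sum ::
    "(nat \<Rightarrow> 'a) \<Rightarrow> (nat \<Rightarrow> 'a \<Rightarrow> 'k::real_or_complex) \<Rightarrow> 'a \<Rightarrow> ('a \<Rightarrow> 'k) \<Rightarrow> real"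
  where "frame_sum a b u f = (\<Sum>m. norm (b m u) * norm (f (a m)))"

text \<open>A Banach space with a Besselian Schauder frame. Below, \<open>dball\<close> is the dual unit ball of the
  original norm and \<open>N\<close> the Besselian norm.\<close>
locale besselian_frame = banach_over scale
  for scale :: "'k::real_or_complex \<Rightarrow> 'a::banach \<Rightarrow> 'a" +
  fixes a :: "nat \<Rightarrow> 'a" and b :: "nat \<Rightarrow> 'a \<Rightarrow> 'k"
  assumes frame: "besselian_schauder_frame scale a b"
begin

abbreviation "dball \<equiv> dual_ball scale norm"
abbreviation "S \<equiv> frame_sum a b"
abbreviation "N \<equiv> bess_norm scale a b"

lemma b_dual: "b m \<in> dual scale norm"
  and expansion: "(\<lambda>m. scale (b m u) (a m)) sums u"
  using frame by (auto simp: besselian_schauder_frame_def schauder_frame_def)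

lemma ball_dual: "f \<in> dball \<Longrightarrow> f \<in> dual scale norm"
  by (simp add: dual_ball_def)

lemma zero_in_ball: "(\<lambda>_. 0) \<in> dball"
  by (rule zero_in_dual_ball) (auto intro: vector_space_axioms)

lemma summable_frame: "f \<in> dual scale norm \<Longrightarrow> summable (\<lambda>m. norm (b m u) * norm (f (a m)))"
  using frame by (auto simp: besselian_schauder_frame_def)

lemma frame_sum_nonneg: "f \<in> dual scale norm \<Longrightarrow> 0 \<le> S u f"
  unfolding frame_sum_def by (intro suminf_nonneg summable_frame) auto

lemma frame_sum_zero: "S 0 f = 0"
  by (simp add: frame_sum_def dual_zero[OF b_dual])

lemma frame_sum_add:
  assumes "f \<in> dual scale norm"
  shows "S (u + v) f \<le> S u f + S v f"
proof -
  note sm = summable_frame[OF assms]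
  have "S (u + v) f \<le> (\<Sum>m. norm (b m u) * norm (f (a m)) + norm (b m v) * norm (f (a m)))"
    unfolding frame_sum_def
    by (intro suminf_le sm summable_add)
      (simp add: dual_add[OF b_dual] norm_triangle_ineq mult_right_mono flip: distrib_right)
  also have "\<dots> = S u f + S v f"
    unfolding frame_sum_def by (intro suminf_add[symmetric] sm)
  finally show ?thesis .
qed

lemma frame_sum_scale: "f \<in> dual scale norm \<Longrightarrow> S (scale c u) f = norm c * S u f"
  unfolding frame_sum_def
  by (subst suminf_mult[symmetric]) (simp_all add: summable_frame dual_scale[OF b_dual] norm_mult mult.assoc)

lemma frame_sum_sum:
  "f \<in> dual scale norm \<Longrightarrow> S (\<Sum>m\<in>A. h m) f \<le> (\<Sum>m\<in>A. S (h m) f)"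
  by (induction A rule: infinite_finite_induct)
    (auto simp: frame_sum_zero intro: order_trans[OF frame_sum_add])

lemma frame_sum_sum_list:
  "f \<in> dual scale norm \<Longrightarrow> S (\<Sum>p\<leftarrow>l. h p) f \<le> (\<Sum>p\<leftarrow>l. S (h p) f)"
  by (induction l) (auto simp: frame_sum_zero intro: order_trans[OF frame_sum_add])

lemma frame_sum_bound:
  obtains B where "0 < B" "\<And>u f. f \<in> dball \<Longrightarrow> S u f \<le> B * norm u"
proof -
  obtain B where B: "0 < B"
    "\<And>u f. f \<in> dual scale norm \<Longrightarrow> S u f \<le> B * norm u * dual_norm norm f"
    using frame by (auto simp: besselian_schauder_frame_def frame_sum_def)
  have "S u f \<le> B * norm u" if "f \<in> dball" for u f
  proof -
    have "B * norm u * dual_norm norm f \<le> B * norm u * 1"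
      using that B(1) by (intro mult_left_mono) (auto simp: dual_ball_def)
    then show ?thesis using B(2)[OF ball_dual[OF that], of u] by simp
  qed
  then show ?thesis using B(1) that by blast
qed

lemma bess_norm_eq: "N u = (SUP f\<in>dball. S u f)"
  by (simp add: bess_norm_def frame_sum_def norm_mult)

lemma bdd_frame_sum: "bdd_above (S u ` dball)"
  using frame_sum_bound by (metis bdd_aboveI2)

lemma frame_sum_le_bess_norm: "f \<in> dball \<Longrightarrow> S u f \<le> N u"
  unfolding bess_norm_eq by (rule cSUP_upper[OF _ bdd_frame_sum])

lemma bess_norm_le: "(\<And>f. f \<in> dball \<Longrightarrow> S u f \<le> c) \<Longrightarrow> N u \<le> c"
  unfolding bess_norm_eq using zero_in_ball by (intro cSUP_least) auto

lemma bess_norm_nonneg: "0 \<le> N u"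
  using frame_sum_le_bess_norm[OF zero_in_ball] frame_sum_nonneg[OF ball_dual[OF zero_in_ball]]
  by (rule order_trans[rotated])

lemma bess_norm_scale: "N (scale c u) = norm c * N u"
proof (cases "c = 0")
  case True
  have "N 0 \<le> 0" by (rule bess_norm_le) (simp add: frame_sum_zero)
  then show ?thesis using bess_norm_nonneg[of 0] True by simp
next
  case False
  have le: "N (scale c u) \<le> norm c * N u" for c u
    by (rule bess_norm_le)
      (simp add: frame_sum_scale[OF ball_dual] mult_left_mono frame_sum_le_bess_norm)
  have "N u \<le> inverse (norm c) * N (scale c u)"
    using le[of "inverse c" "scale c u"] False by (simp add: norm_inverse)
  then show ?thesis using le[of c u] False by (simp add: field_simps)
qed

lemma bess_norm_zero: "N 0 = 0"
  using bess_norm_scale[of 0 0] by simp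

lemma norm_le_bess_dual_norm: "f \<in> dual scale N \<Longrightarrow> norm (f u) \<le> dual_norm N f * N u"
  by (rule norm_dual_le[where s = scale]) (simp_all add: bess_norm_nonneg bess_norm_scale)

lemma bess_dual_norm_nonneg: "f \<in> dual scale N \<Longrightarrow> 0 \<le> dual_norm N f"
  by (rule dual_norm_nonneg[where s = scale]) (simp_all add: bess_norm_nonneg bess_norm_zero)

text \<open>The frame expansion of \<open>u\<close> is carried termwise by the continuous functional \<open>f\<close>.\<close>
lemma norm_le_frame_sum:
  assumes f: "f \<in> dual scale norm"
  shows "norm (f u) \<le> S u f"
proof -
  obtain C where C: "0 \<le> C" "\<And>v. norm (f v) \<le> C * norm v"
    using dual_bounded[OF f] by auto
  let ?X = "\<lambda>n. \<Sum>m<n. scale (b m u) (a m)"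
  have "?X \<longlonglongrightarrow> u" using expansion[of u] by (simp only: sums_def)
  then have "(\<lambda>n. C * norm (?X n - u)) \<longlonglongrightarrow> C * 0"
    by (intro tendsto_mult_left tendsto_norm_zero LIM_zero)
  then have "(\<lambda>n. C * norm (?X n - u)) \<longlonglongrightarrow> 0" by (simp only: mult_zero_right)
  moreover have "\<forall>n. norm (f (?X n) - f u) \<le> C * norm (?X n - u)"
    unfolding dual_diff[OF f, symmetric] by (blast intro: C(2))
  ultimately have "(\<lambda>n. f (?X n) - f u) \<longlonglongrightarrow> 0"
    by (rule Lim_null_comparison[OF always_eventually, rotated])
  then have lim: "(\<lambda>n. f (?X n)) \<longlonglongrightarrow> f u"
    by (rule LIM_zero_cancel)
  have le: "norm (f (?X n)) \<le> S u f" for n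
  proof -
    have "norm (f (?X n)) \<le> (\<Sum>m<n. norm (b m u) * norm (f (a m)))"
      unfolding dual_sum[OF f] by (rule sum_norm_le) (simp add: dual_scale[OF f] norm_mult)
    also have "\<dots> \<le> S u f"
      unfolding frame_sum_def by (intro sum_le_suminf summable_frame f) auto
    finally show ?thesis .
  qed
  show ?thesis
    by (rule tendsto_upperbound[OF tendsto_norm[OF lim]]) (auto simp: le)
qed

text \<open>
  If the constant \<open>L\<close> is not 0, there is a functional \<open>f\<close> of norm 1, and \<open>norm (f v) \<le> S v f \<le> L\<close> on
  the unit ball forces \<open>1 \<le> L\<close>. The value 0 does occur, on the zero space.\<close>
lemma bess_const_cases: "bess_const scale a b = 0 \<or> 1 \<le> bess_const scale a b"
proof (cases "\<forall>u f. norm u \<le> 1 \<longrightarrow> f \<in> dball \<longrightarrow> S u f = 0")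
  case True
  have "bess_const scale a b = (SUP p\<in>{u :: 'a. norm u \<le> 1} \<times> dball. 0)"
    unfolding bess_const_def
    by (rule SUP_cong[OF refl]) (use True in \<open>auto simp: frame_sum_def\<close>)
  also have "\<dots> = 0" using zero_in_ball by (intro cSUP_const) (auto intro!: exI[of _ 0])
  finally show ?thesis by simp
next
  case False
  let ?L = "bess_const scale a b"
  obtain B where B: "0 < B" "\<And>u f. f \<in> dball \<Longrightarrow> S u f \<le> B * norm u"
    using frame_sum_bound by blast
  have bdd: "bdd_above ((\<lambda>(u, f). S u f) ` ({u. norm u \<le> 1} \<times> dball))"
  proof (rule bdd_aboveI2, clarify)
    fix u :: 'a and f assume "norm u \<le> 1" "f \<in> dball"
    then have "S u f \<le> B * norm u" "B * norm u \<le> B * 1"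
      using B by (auto simp: mult_left_mono)
    then show "S u f \<le> B" by linarith
  qed
  have S_le: "S u f \<le> ?L" if "norm u \<le> 1" "f \<in> dball" for u f
    unfolding bess_const_def frame_sum_def[symmetric]
    using cSUP_upper[OF _ bdd, of "(u, f)"] that by simp
  obtain u f where uf: "norm u \<le> 1" "f \<in> dball" "S u f \<noteq> 0" using False by blast
  have f: "f \<in> dual scale norm" by (rule ball_dual[OF uf(2)])
  define d where "d = dual_norm norm f"
  have norm_f: "norm (f v) \<le> d * norm v" for v
    unfolding d_def by (rule norm_dual_le[OF f]) (auto simp: norm_scale)
  have "d \<noteq> 0"
  proof
    assume "d = 0"
    then have "f v = 0" for v using norm_f[of v] by simp
    then show False using uf(3) by (simp add: frame_sum_def)
  qed
  moreover have "0 \<le> d" unfolding d_def by (rule dual_norm_nonneg[OF f]) auto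
  ultimately have d: "0 < d" by simp
  define g where "g = (\<lambda>v. of_real (inverse d) * f v)"
  have g: "g \<in> dball"
    unfolding g_def by (rule rescale_in_dual_ball[OF f]) (use d in \<open>auto simp: d_def\<close>)
  have "norm (f v) \<le> d * ?L" if "norm v \<le> 1" for v
  proof -
    have "norm (g v) \<le> ?L"
      using norm_le_frame_sum[OF ball_dual[OF g]] S_le[OF that g] by (rule order_trans)
    then show ?thesis using d by (simp add: g_def norm_mult norm_divide field_simps)
  qed
  then have "d \<le> d * ?L" unfolding d_def by (intro dual_norm_le) auto
  then show ?thesis using d by simp
qed

text \<open>Indices with \<open>a m = 0\<close> do not contribute to the expansion. They are left out because the bound on
  \<open>b m\<close> by the Besselian norm in \<open>b_bess_dual\<close> uses a functional that does not vanish at \<open>a m\<close>.\<close>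
lemma b_separates:
  assumes "\<And>m. a m \<noteq> 0 \<Longrightarrow> b m u = 0"
  shows "u = 0"
proof -
  have "scale (b m u) (a m) = 0" for m using assms[of m] by (cases "a m = 0") auto
  then have "(\<lambda>_. 0) sums u" using expansion[of u] by presburger
  then show ?thesis using sums_zero sums_unique2 by blast
qed

lemma b_bess_dual:
  assumes "a m \<noteq> 0"
  shows "b m \<in> dual scale N"
proof -
  \<comment> \<open>A multiple of \<open>b k\<close> is a member \<open>f\<close> of the dual ball with \<open>f (a m) \<noteq> 0\<close>, and the \<open>m\<close>-th term of
    \<open>S u f\<close> then bounds \<open>b m u\<close>.\<close>
  obtain k where k: "b k (a m) \<noteq> 0" using b_separates assms by blast
  define d where "d = dual_norm norm (b k) + 1"
  have d: "0 < d" using dual_norm_nonneg[OF b_dual, of k] by (simp add: d_def)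
  define f where "f = (\<lambda>v. of_real (inverse d) * b k v)"
  have f: "f \<in> dball"
    unfolding f_def by (rule rescale_in_dual_ball[OF b_dual]) (use d in \<open>auto simp: d_def\<close>)
  have fa: "0 < norm (f (a m))" using k d by (simp add: f_def)
  have "norm (b m u) \<le> inverse (norm (f (a m))) * N u" for u
  proof -
    have "norm (b m u) * norm (f (a m)) \<le> S u f"
      unfolding frame_sum_def using sum_le_suminf[OF summable_frame[OF ball_dual[OF f]], of "{m}" u] by auto
    also have "\<dots> \<le> N u" by (rule frame_sum_le_bess_norm[OF f])
    finally show ?thesis using fa by (simp add: field_simps)
  qed
  then show ?thesis using b_dual[of m] by (auto simp: dual_def)
qed

end

section \<open>The Besselian crossnorm\<close>

lemma elem_tensor_eq_sum: "elem_tensor s t v w = tensor_sum s t [(v, w)]"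
  by (simp add: tensor_sum_def)

lemma tensor_add_sum: "tensor_add (tensor_sum s t p) (tensor_sum s t q) = tensor_sum s t (p @ q)"
  by (simp add: tensor_sum_def tensor_add_def)

lemma tensor_scale_sum:
  assumes "vector_space s" "vector_space t"
  shows "tensor_scale c (tensor_sum s t p) = tensor_sum s t (map (\<lambda>(v, w). (s c v, w)) p)"
proof -
  have "c * elem_tensor s t v w A = elem_tensor s t (s c v) w A" for v w A
    using bilinear_elem_tensor(3)[OF assms, of c v w] by (simp add: tensor_scale_def)
  then show ?thesis
    by (induction p) (auto simp: tensor_sum_def tensor_scale_def fun_eq_iff ring_distribs)
qed

text \<open>\<open>E.N\<close> and \<open>F.N\<close> are the two Besselian norms; \<open>E.S\<close> and \<open>F.S\<close> are the two series above.\<close>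
locale two_besselian_frames =
  E: besselian_frame s a b + F: besselian_frame t x y
  for s :: "'k::real_or_complex \<Rightarrow> 'a::banach \<Rightarrow> 'a" and a b
    and t :: "'k \<Rightarrow> 'b::banach \<Rightarrow> 'b" and x y
begin

abbreviation "Bess \<equiv> bess_rep s a b t x y"
abbreviation "\<alpha> \<equiv> bess_crossnorm s a b t x y"

text \<open>The double series factors, since \<open>b m v * y n w * f (a m) * g (x n)\<close> is a product of a term
  in \<open>m\<close> and a term in \<open>n\<close>.\<close>
lemma bess_rep_eq: "Bess rep = (SUP (f, g)\<in>E.dball \<times> F.dball. \<Sum>(v, w)\<leftarrow>rep. E.S v f * F.S w g)"
  unfolding bess_rep_def
proof (rule SUP_cong[OF refl], clarify)
  fix f g assume fg: "f \<in> E.dball" "g \<in> F.dball"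
  have split: "norm (b m v * y n w * f (a m) * g (x n)) =
      (norm (b m v) * norm (f (a m))) * (norm (y n w) * norm (g (x n)))" for m n v w
    by (simp add: norm_mult mult_ac)
  have "(\<Sum>\<^sub>\<infinity>(m, n)\<in>UNIV. norm (b m v * y n w * f (a m) * g (x n))) = E.S v f * F.S w g" for v w
    unfolding frame_sum_def split
    by (intro infsum_prod_eq_suminf_mult E.summable_frame F.summable_frame E.ball_dual F.ball_dual fg) auto
  then show "(\<Sum>(v, w)\<leftarrow>rep. \<Sum>\<^sub>\<infinity>(m, n)\<in>UNIV. norm (b m v * y n w * f (a m) * g (x n))) =
      (\<Sum>(v, w)\<leftarrow>rep. E.S v f * F.S w g)" by simp
qed

lemma sum_frame_sums_le:
  assumes "f \<in> E.dball" "g \<in> F.dball"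
  shows "(\<Sum>(v, w)\<leftarrow>rep. E.S v f * F.S w g) \<le> (\<Sum>(v, w)\<leftarrow>rep. E.N v * F.N w)"
  unfolding case_prod_beta' using assms
  by (intro sum_list_mono mult_mono E.frame_sum_le_bess_norm F.frame_sum_le_bess_norm
      E.bess_norm_nonneg F.frame_sum_nonneg F.ball_dual)

lemma bess_rep_upper:
  assumes "f \<in> E.dball" "g \<in> F.dball"
  shows "(\<Sum>(v, w)\<leftarrow>rep. E.S v f * F.S w g) \<le> Bess rep"
proof -
  have "bdd_above ((\<lambda>(f, g). \<Sum>(v, w)\<leftarrow>rep. E.S v f * F.S w g) ` (E.dball \<times> F.dball))"
    by (rule bdd_aboveI2[where M = "\<Sum>(v, w)\<leftarrow>rep. E.N v * F.N w"])
      (use sum_frame_sums_le in auto)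
  from cSUP_upper[OF _ this, of "(f, g)"] assms show ?thesis by (simp add: bess_rep_eq)
qed

lemma bess_rep_le:
  assumes "\<And>f g. f \<in> E.dball \<Longrightarrow> g \<in> F.dball \<Longrightarrow> (\<Sum>(v, w)\<leftarrow>rep. E.S v f * F.S w g) \<le> c"
  shows "Bess rep \<le> c"
  unfolding bess_rep_eq using assms E.zero_in_ball F.zero_in_ball by (intro cSUP_least) auto

lemma bess_rep_nonneg: "0 \<le> Bess rep"
proof -
  have "0 \<le> (\<Sum>(v, w)\<leftarrow>rep. E.S v (\<lambda>_. 0) * F.S w (\<lambda>_. 0))"
    by (simp add: frame_sum_def case_prod_beta')
  also have "\<dots> \<le> Bess rep" by (rule bess_rep_upper) (rule E.zero_in_ball F.zero_in_ball)+
  finally show ?thesis .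
qed

lemma bess_rep_le_projective: "Bess rep \<le> (\<Sum>(v, w)\<leftarrow>rep. E.N v * F.N w)"
  by (rule bess_rep_le) (rule sum_frame_sums_le)

lemma bess_rep_append: "Bess (p @ q) \<le> Bess p + Bess q"
  by (rule bess_rep_le) (use bess_rep_upper in \<open>fastforce intro: add_mono\<close>)

lemma bess_rep_scale: "Bess (map (\<lambda>(v, w). (s c v, w)) p) \<le> norm c * Bess p"
proof (rule bess_rep_le)
  fix f g assume fg: "f \<in> E.dball" "g \<in> F.dball"
  have "(\<Sum>(v, w)\<leftarrow>map (\<lambda>(v, w). (s c v, w)) p. E.S v f * F.S w g)
      = norm c * (\<Sum>(v, w)\<leftarrow>p. E.S v f * F.S w g)"
    by (simp add: case_prod_beta' o_def E.frame_sum_scale[OF E.ball_dual[OF fg(1)]] mult.assoc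
        flip: sum_list_const_mult)
  also have "\<dots> \<le> norm c * Bess p"
    by (rule mult_left_mono[OF bess_rep_upper[OF fg]]) simp
  finally show "(\<Sum>(v, w)\<leftarrow>map (\<lambda>(v, w). (s c v, w)) p. E.S v f * F.S w g) \<le> norm c * Bess p" .
qed

text \<open>The scalars \<open>c m\<close> may have arbitrary phases, which the seminorm \<open>F.S\<close> does not see; this is what
  makes the estimate applicable in \<open>bess_norm_slice_le\<close>.\<close>
lemma bess_norm_combination_le:
  assumes f: "f \<in> E.dball" and c: "\<And>m. m < K \<Longrightarrow> norm (c m) \<le> norm (f (a m))"
  shows "F.N (\<Sum>m<K. t (c m) (\<Sum>p\<leftarrow>rep. t (b m (fst p)) (snd p))) \<le> Bess rep"
proof (rule F.bess_norm_le)
  fix g assume g: "g \<in> F.dball"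
  note gd = F.ball_dual[OF g]
  let ?w = "\<lambda>m. \<Sum>p\<leftarrow>rep. t (b m (fst p)) (snd p)"
  have w: "F.S (?w m) g \<le> (\<Sum>p\<leftarrow>rep. norm (b m (fst p)) * F.S (snd p) g)" for m
    using F.frame_sum_sum_list[OF gd, where l = rep and h = "\<lambda>p. t (b m (fst p)) (snd p)"]
    by (simp add: F.frame_sum_scale[OF gd])
  have "F.S (\<Sum>m<K. t (c m) (?w m)) g \<le> (\<Sum>m<K. norm (c m) * F.S (?w m) g)"
    using F.frame_sum_sum[OF gd, where A = "{..<K}" and h = "\<lambda>m. t (c m) (?w m)"]
    by (simp add: F.frame_sum_scale[OF gd])
  also have "\<dots> \<le> (\<Sum>m<K. norm (f (a m)) * (\<Sum>p\<leftarrow>rep. norm (b m (fst p)) * F.S (snd p) g))"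
    using c w by (intro sum_mono mult_mono) (auto simp: F.frame_sum_nonneg[OF gd])
  also have "\<dots> = (\<Sum>p\<leftarrow>rep. (\<Sum>m<K. norm (b m (fst p)) * norm (f (a m))) * F.S (snd p) g)"
    by (simp add: sum_sum_list_swap sum_distrib_left mult_ac flip: sum_list_const_mult)
  also have "\<dots> \<le> (\<Sum>p\<leftarrow>rep. E.S (fst p) f * F.S (snd p) g)"
    by (intro sum_list_mono mult_right_mono F.frame_sum_nonneg[OF gd])
      (auto simp: frame_sum_def intro!: sum_le_suminf E.summable_frame E.ball_dual[OF f])
  also have "\<dots> \<le> Bess rep"
    using bess_rep_upper[OF f g, of rep] by (simp add: case_prod_beta')
  finally show "F.S (\<Sum>m<K. t (c m) (?w m)) g \<le> Bess rep" .
qed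

text \<open>Applying \<open>g\<close> to the second factors of a representation gives a vector of the first space. Its
  Besselian norm is controlled by the norm of \<open>g\<close> dual to the Besselian norm, without a further constant.\<close>
lemma bess_norm_slice_le:
  assumes g: "g \<in> dual t F.N"
  shows "E.N (\<Sum>p\<leftarrow>rep. s (g (snd p)) (fst p)) \<le> dual_norm F.N g * Bess rep"
proof (rule E.bess_norm_le)
  fix f assume f: "f \<in> E.dball"
  let ?v = "\<Sum>p\<leftarrow>rep. s (g (snd p)) (fst p)"
  let ?w = "\<lambda>m. \<Sum>p\<leftarrow>rep. t (b m (fst p)) (snd p)"
  have bv: "b m ?v = g (?w m)" for m
    by (simp add: dual_sum_list[OF E.b_dual] dual_sum_list[OF g] dual_scale[OF E.b_dual]
        dual_scale[OF g] mult.commute)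
  show "E.S ?v f \<le> dual_norm F.N g * Bess rep"
    unfolding frame_sum_def
  proof (rule suminf_le_const[OF E.summable_frame[OF E.ball_dual[OF f]]])
    fix K
    \<comment> \<open>The second factor of \<open>c m\<close> rotates \<open>g (?w m)\<close> to its absolute value; it is 0 when
      \<open>g (?w m) = 0\<close>, by the convention for division by 0.\<close>
    define c where "c m = of_real (norm (f (a m))) * (of_real (norm (g (?w m))) / g (?w m))" for m
    have c: "norm (c m) \<le> norm (f (a m))" for m
      by (cases "g (?w m) = 0") (simp_all add: c_def norm_mult norm_divide)
    have cw: "c m * g (?w m) = of_real (norm (b m ?v) * norm (f (a m)))" for m
      by (cases "g (?w m) = 0") (simp_all add: c_def bv)
    have "(\<Sum>m<K. norm (b m ?v) * norm (f (a m))) = norm (g (\<Sum>m<K. t (c m) (?w m)))"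
    proof -
      have "g (\<Sum>m<K. t (c m) (?w m)) = of_real (\<Sum>m<K. norm (b m ?v) * norm (f (a m)))"
        by (simp only: dual_sum[OF g] dual_scale[OF g] cw of_real_sum)
      then show ?thesis by (simp only: norm_of_real) (simp add: sum_nonneg)
    qed
    also have "\<dots> \<le> dual_norm F.N g * F.N (\<Sum>m<K. t (c m) (?w m))"
      by (rule F.norm_le_bess_dual_norm[OF g])
    also have "\<dots> \<le> dual_norm F.N g * Bess rep"
      by (intro mult_left_mono bess_norm_combination_le[OF f c] F.bess_dual_norm_nonneg g)
    finally show "(\<Sum>m<K. norm (b m ?v) * norm (f (a m))) \<le> dual_norm F.N g * Bess rep" .
  qed
qed

lemma functional_le_bess_rep:
  assumes f: "f \<in> dual s E.N" and g: "g \<in> dual t F.N"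
  shows "norm (\<Sum>(v, w)\<leftarrow>rep. f v * g w) \<le> dual_norm E.N f * dual_norm F.N g * Bess rep"
proof -
  let ?v = "\<Sum>p\<leftarrow>rep. s (g (snd p)) (fst p)"
  have "(\<Sum>(v, w)\<leftarrow>rep. f v * g w) = f ?v"
    by (simp add: dual_sum_list[OF f] dual_scale[OF f] mult.commute case_prod_beta')
  also have "norm \<dots> \<le> dual_norm E.N f * E.N ?v"
    by (rule E.norm_le_bess_dual_norm[OF f])
  also have "\<dots> \<le> dual_norm E.N f * (dual_norm F.N g * Bess rep)"
    by (intro mult_left_mono bess_norm_slice_le g E.bess_dual_norm_nonneg f)
  finally show ?thesis by (simp add: mult.assoc)
qed

lemma crossnorm_le: "\<alpha> (tensor_sum s t rep) \<le> Bess rep"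
  unfolding bess_crossnorm_def
  by (rule cINF_lower) (auto intro!: bdd_belowI2 bess_rep_nonneg)

lemma crossnorm_ge:
  assumes "u \<in> tensor_space s t" "\<And>rep. u = tensor_sum s t rep \<Longrightarrow> c \<le> Bess rep"
  shows "c \<le> \<alpha> u"
  unfolding bess_crossnorm_def
  by (rule cINF_greatest) (use assms in \<open>auto simp: tensor_space_def\<close>)

lemma crossnorm_nonneg: "u \<in> tensor_space s t \<Longrightarrow> 0 \<le> \<alpha> u"
  by (rule crossnorm_ge) (simp_all add: bess_rep_nonneg)

text \<open>The infimum over representations is taken after division by the product of the dual norms, so that
  the case of a zero product is separate.\<close>
lemma functional_le_crossnorm:
  assumes f: "f \<in> dual s E.N" and g: "g \<in> dual t F.N" and u: "u \<in> tensor_space s t"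
  shows "norm (tensor_functional f g u) \<le> dual_norm E.N f * dual_norm F.N g * \<alpha> u"
proof -
  define d where "d = dual_norm E.N f * dual_norm F.N g"
  have d: "0 \<le> d" by (simp add: d_def E.bess_dual_norm_nonneg[OF f] F.bess_dual_norm_nonneg[OF g])
  have le: "norm (tensor_functional f g u) \<le> d * Bess rep" if "u = tensor_sum s t rep" for rep
    using functional_le_bess_rep[OF f g, of rep] tensor_functional_sum[OF f g, of rep] that
    by (simp add: d_def)
  show ?thesis
  proof (cases "d = 0")
    case True
    then show ?thesis using le u by (auto simp: tensor_space_def d_def[symmetric])
  next
    case False
    have "norm (tensor_functional f g u) / d \<le> \<alpha> u"
      by (rule crossnorm_ge[OF u]) (use le d False in \<open>simp add: field_simps\<close>)
    then show ?thesis using d False by (simp add: d_def[symmetric] field_simps)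
  qed
qed

lemma crossnorm_le_projective:
  assumes "u \<in> tensor_space s t"
  shows "\<alpha> u \<le> projective_norm s E.N t F.N u"
  unfolding projective_norm_def
proof (rule cINF_greatest)
  show "{rep. tensor_sum s t rep = u} \<noteq> {}" using assms by (auto simp: tensor_space_def)
  show "\<alpha> u \<le> (\<Sum>(v, w)\<leftarrow>rep. E.N v * F.N w)" if "rep \<in> {rep. tensor_sum s t rep = u}" for rep
    using that crossnorm_le[of rep] bess_rep_le_projective[of rep] by auto
qed

lemma injective_le_crossnorm:
  assumes u: "u \<in> tensor_space s t"
  shows "injective_norm s E.N t F.N u \<le> \<alpha> u"
  unfolding injective_norm_def
proof (rule cSUP_least, goal_cases)
  case 1
  show ?case
    using zero_in_dual_ball[of s E.N, OF E.vector_space_axioms E.bess_norm_zero]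
      zero_in_dual_ball[of t F.N, OF F.vector_space_axioms F.bess_norm_zero] by auto
next
  case (2 fg)
  then obtain f g where fg: "fg = (f, g)" "f \<in> dual s E.N" "g \<in> dual t F.N"
    "dual_norm E.N f \<le> 1" "dual_norm F.N g \<le> 1" by (auto simp: dual_ball_def)
  have "norm (tensor_functional f g u) \<le> dual_norm E.N f * dual_norm F.N g * \<alpha> u"
    by (rule functional_le_crossnorm[OF fg(2,3) u])
  also have "\<dots> \<le> 1 * 1 * \<alpha> u"
    by (intro mult_mono fg crossnorm_nonneg u) (use E.bess_dual_norm_nonneg F.bess_dual_norm_nonneg fg in auto)
  finally show ?case by (simp add: fg(1))
qed

lemma crossnorm_eq_zero_imp:
  assumes u: "u \<in> tensor_space s t" and "\<alpha> u = 0"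
  shows "u = tensor_zero"
proof -
  obtain rep where rep: "u = tensor_sum s t rep" using u by (auto simp: tensor_space_def)
  have "tensor_sum s t rep = tensor_zero"
  proof (rule tensor_sum_eq_zeroI[where \<Phi> = "b ` {m. a m \<noteq> 0}" and \<Psi> = "y ` {n. x n \<noteq> 0}"])
    show "vector_space t" by (rule F.vector_space_axioms)
    show "Vector_Spaces.linear s (*) \<phi>" if "\<phi> \<in> b ` {m. a m \<noteq> 0}" for \<phi>
      using that E.b_dual by (auto simp: dual_def)
    show "Vector_Spaces.linear t (*) \<psi>" if "\<psi> \<in> y ` {n. x n \<noteq> 0}" for \<psi>
      using that F.b_dual by (auto simp: dual_def)
    show "v = 0" if "\<And>\<phi>. \<phi> \<in> b ` {m. a m \<noteq> 0} \<Longrightarrow> \<phi> v = 0" for v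
      using that by (intro E.b_separates) auto
    show "w = 0" if "\<And>\<psi>. \<psi> \<in> y ` {n. x n \<noteq> 0} \<Longrightarrow> \<psi> w = 0" for w
      using that by (intro F.b_separates) auto
    show "(\<Sum>(v, w)\<leftarrow>rep. \<phi> v * \<psi> w) = 0"
      if "\<phi> \<in> b ` {m. a m \<noteq> 0}" "\<psi> \<in> y ` {n. x n \<noteq> 0}" for \<phi> \<psi>
    proof -
      have d: "\<phi> \<in> dual s E.N" "\<psi> \<in> dual t F.N"
        using that E.b_bess_dual F.b_bess_dual by auto
      show ?thesis
        using functional_le_crossnorm[OF d u] assms(2) tensor_functional_sum[OF d, of rep] rep by simp
    qed
  qed
  then show ?thesis using rep by simp
qed

lemma crossnorm_zero: "\<alpha> tensor_zero = 0"
proof -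
  have z: "tensor_zero = tensor_sum s t []" by (simp add: tensor_zero_def tensor_sum_def)
  have "Bess [] \<le> 0" by (rule bess_rep_le) simp
  then show ?thesis
    using crossnorm_le[of "[]"] crossnorm_nonneg[of tensor_zero] z by (auto simp: tensor_space_def)
qed

lemma tensor_space_scale: "u \<in> tensor_space s t \<Longrightarrow> tensor_scale c u \<in> tensor_space s t"
  using tensor_scale_sum[OF E.vector_space_axioms F.vector_space_axioms, of c]
  by (auto simp: tensor_space_def)

lemma crossnorm_scale_le:
  assumes u: "u \<in> tensor_space s t"
  shows "\<alpha> (tensor_scale c u) \<le> norm c * \<alpha> u"
proof (cases "c = 0")
  case True
  then have "tensor_scale c u = tensor_zero" by (simp add: tensor_scale_def tensor_zero_def)
  then show ?thesis using True by (simp add: crossnorm_zero)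
next
  case False
  have "\<alpha> (tensor_scale c u) / norm c \<le> \<alpha> u"
  proof (rule crossnorm_ge[OF u])
    fix rep assume "u = tensor_sum s t rep"
    then have "\<alpha> (tensor_scale c u) \<le> norm c * Bess rep"
      using crossnorm_le[of "map (\<lambda>(v, w). (s c v, w)) rep"] bess_rep_scale[of c rep]
      by (simp add: tensor_scale_sum[OF E.vector_space_axioms F.vector_space_axioms])
    then show "\<alpha> (tensor_scale c u) / norm c \<le> Bess rep" using False by (simp add: field_simps)
  qed
  then show ?thesis using False by (simp add: field_simps)
qed

lemma crossnorm_scale:
  assumes u: "u \<in> tensor_space s t"
  shows "\<alpha> (tensor_scale c u) = norm c * \<alpha> u"
proof (cases "c = 0")
  case True
  then show ?thesis
    using crossnorm_scale_le[OF u, of c] crossnorm_nonneg[OF tensor_space_scale[OF u, of c]] by simp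
next
  case False
  have "tensor_scale (inverse c) (tensor_scale c u) = u"
    using False by (simp add: tensor_scale_def mult.assoc[symmetric])
  then have "\<alpha> u \<le> inverse (norm c) * \<alpha> (tensor_scale c u)"
    using crossnorm_scale_le[OF tensor_space_scale[OF u, of c], of "inverse c"] by (simp add: norm_inverse)
  then show ?thesis using crossnorm_scale_le[OF u, of c] False by (simp add: field_simps)
qed

lemma crossnorm_triangle:
  assumes u: "u \<in> tensor_space s t" and v: "v \<in> tensor_space s t"
  shows "\<alpha> (tensor_add u v) \<le> \<alpha> u + \<alpha> v"
proof -
  have le: "\<alpha> (tensor_add u v) \<le> Bess p + Bess q" if "u = tensor_sum s t p" "v = tensor_sum s t q" for p q
    using that crossnorm_le[of "p @ q"] bess_rep_append[of p q] by (simp add: tensor_add_sum)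
  have "\<alpha> (tensor_add u v) - \<alpha> u \<le> \<alpha> v"
  proof (rule crossnorm_ge[OF v])
    fix q assume q: "v = tensor_sum s t q"
    have "\<alpha> (tensor_add u v) - Bess q \<le> \<alpha> u"
      by (rule crossnorm_ge[OF u]) (use le q in \<open>force simp: algebra_simps\<close>)
    then show "\<alpha> (tensor_add u v) - \<alpha> u \<le> Bess q" by simp
  qed
  then show ?thesis by simp
qed

lemma reasonable_crossnorm_bess: "reasonable_crossnorm s E.N t F.N \<alpha>"
proof -
  have "norm_on_tensor s t \<alpha>"
    using crossnorm_nonneg crossnorm_eq_zero_imp crossnorm_zero crossnorm_scale crossnorm_triangle
    by (auto simp: norm_on_tensor_def)
  moreover have "\<alpha> (elem_tensor s t v w) \<le> E.N v * F.N w" for v w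
    using crossnorm_le[of "[(v, w)]"] bess_rep_le_projective[of "[(v, w)]"]
    by (simp add: elem_tensor_eq_sum)
  ultimately show ?thesis
    using functional_le_crossnorm by (simp add: reasonable_crossnorm_def)
qed

lemma weighted_injective_le_crossnorm:
  assumes u: "u \<in> tensor_space s t"
  shows "inverse (bess_const s a b) * inverse (bess_const t x y) * injective_norm s E.N t F.N u \<le> \<alpha> u"
proof -
  let ?l = "inverse (bess_const s a b) * inverse (bess_const t x y)"
  have "0 \<le> inverse (bess_const s a b)" "inverse (bess_const s a b) \<le> 1"
    "0 \<le> inverse (bess_const t x y)" "inverse (bess_const t x y) \<le> 1"
    using E.bess_const_cases F.bess_const_cases by (auto simp: inverse_le_1_iff)
  then have l: "0 \<le> ?l" "?l \<le> 1" by (auto intro: mult_le_one)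
  have "?l * injective_norm s E.N t F.N u \<le> ?l * \<alpha> u"
    by (rule mult_left_mono[OF injective_le_crossnorm[OF u] l(1)])
  also have "\<dots> \<le> 1 * \<alpha> u" by (rule mult_right_mono[OF l(2) crossnorm_nonneg[OF u]])
  finally show ?thesis by simp
qed

end

theorem proposition1:
  fixes sE :: "'k::real_or_complex \<Rightarrow> 'a::banach \<Rightarrow> 'a"
    and sF :: "'k \<Rightarrow> 'b::banach \<Rightarrow> 'b"
    and a :: "nat \<Rightarrow> 'a" and b :: "nat \<Rightarrow> 'a \<Rightarrow> 'k"
    and x :: "nat \<Rightarrow> 'b" and y :: "nat \<Rightarrow> 'b \<Rightarrow> 'k"
  assumes "banach_over sE" and "banach_over sF"
    and "besselian_schauder_frame sE a b" and "besselian_schauder_frame sF x y"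
  shows
    "(\<forall>u\<in>tensor_space sE sF.
        inverse (bess_const sE a b) * inverse (bess_const sF x y) *
            injective_norm sE (bess_norm sE a b) sF (bess_norm sF x y) u
          \<le> bess_crossnorm sE a b sF x y u \<and>
        bess_crossnorm sE a b sF x y u
          \<le> projective_norm sE (bess_norm sE a b) sF (bess_norm sF x y) u) \<and>
     reasonable_crossnorm sE (bess_norm sE a b) sF (bess_norm sF x y)
        (bess_crossnorm sE a b sF x y) \<and>
     (\<forall>u\<in>tensor_space sE sF.
        injective_norm sE (bess_norm sE a b) sF (bess_norm sF x y) u
          \<le> bess_crossnorm sE a b sF x y u \<and>
        bess_crossnorm sE a b sF x y u
          \<le> projective_norm sE (bess_norm sE a b) sF (bess_norm sF x y) u)"
proof -
  interpret two_besselian_frames sE a b sF x y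
    using assms by (intro two_besselian_frames.intro besselian_frame.intro besselian_frame_axioms.intro)
  show ?thesis
    by (intro conjI ballI weighted_injective_le_crossnorm injective_le_crossnorm
        crossnorm_le_projective reasonable_crossnorm_bess)
qed

end
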